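(* Let $\mathfrak{F}$ be a free filter on $\mathbb{N}$. If $\mathfrak{F}$ is conglomerated, then $\mathfrak{F}$ is not poor; and so, in particular, $\mathfrak{F}$ is not generated by a statistical measure.
   Context: A filter on $\mathbb{N}$ is a non-empty collection of subsets of $\mathbb{N}$ not containing $\emptyset$, closed under finite intersections and supersets. It is free if it contains every subset with finite complement. For a filter $\mathfrak{F}$ put $\mathcal{I}(\mathfrak{F})=\{\mathbb{N}\setminus A : A\in\mathfrak{F}\}$ (the ideal of $\mathfrak{F}$) and $\mathfrak{G}(\mathfrak{F})=2^{\mathbb{N}}\setminus\mathcal{I}(\mathfrak{F})$ (the grill of $\mathfrak{F}$), where $2^{\mathbb{N}}$ is the collection of all subsets of $\mathbb{N}$. Two sets $A,B\subset\mathbb{N}$ are $\mathfrak{F}$-almost disjoint if $A\cap B\in\mathcal{I}(\mathfrak{F})$. A free filter $\mathfrak{F}$ is poor if every collection of pairwise $\mathfrak{F}$-almost disjoint sets $\{A_\gamma\}_{\gamma\in\Gamma}\subset\mathfrak{G}(\mathfrak{F})$ is at most countable. A free filter $\mathfrak{F}$ is conglomerated if there is a sequence of pairwise disjoint sets $D_n\in\mathcal{I}(\mathfrak{F})$, $n\in\mathbb{N}$, such that $\bigcup_{n\in M}D_n\in\mathfrak{G}(\mathfrak{F})$ for every infinite subset $M\subset\mathbb{N}$. A statistical measure is a non-negative finitely additive measure $\mu$ defined on all subsets of $\mathbb{N}$ with $\mu(\mathbb{N})=1$ and $\mu(\{k\})=0$ for all $k\in\mathbb{N}$. The filter generated by $\mu$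 is $\mathfrak{F}_\mu=\{A\subset\mathbb{N}:\mu(A)=1\}$; $\mathfrak{F}$ is generated by a statistical measure if $\mathfrak{F}=\mathfrak{F}_\mu$ for some statistical measure $\mu$. *)

theory Defs
  imports "HOL-Analysis.Measure_Space"
begin

text \<open>
  Filters on the natural numbers are rendered by the library type of filters.  As
  that type also contains the improper filter \<open>bot\<close> (the only one containing the
  empty set), properness is required explicitly in \<open>free_filter\<close>.
\<close>

definition filter_sets :: "'a filter \<Rightarrow> 'a set set" where
  "filter_sets F = {A. eventually (\<lambda>n. n \<in> A) F}"

definition free_filter :: "nat filter \<Rightarrow> bool" where
  "free_filter F \<longleftrightarrow> F \<noteq> bot \<and> (\<forall>A. finite (- A) \<longrightarrow> A \<in> filter_sets F)"

definition filter_ideal :: "nat filter \<Rightarrow> nat set set" where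
  "filter_ideal F = {UNIV - A | A. A \<in> filter_sets F}"

definition filter_grill :: "nat filter \<Rightarrow> nat set set" where
  "filter_grill F = UNIV - filter_ideal F"

definition almost_disjoint :: "nat filter \<Rightarrow> nat set \<Rightarrow> nat set \<Rightarrow> bool" where
  "almost_disjoint F A B \<longleftrightarrow> A \<inter> B \<in> filter_ideal F"

text \<open>
  In the next definition a collection is a set of sets.  An indexed family in the grill whose
  members at different indices are almost disjoint is injective, since
  \<open>A \<inter> A = A\<close> is not in the ideal, so nothing is lost by not indexing.
\<close>

definition poor :: "nat filter \<Rightarrow> bool" where
  "poor F \<longleftrightarrow> free_filter F \<and>
     (\<forall>\<A> \<subseteq> filter_grill F. pairwise (almost_disjoint F) \<A> \<longrightarrow> countable \<A>)"

definition conglomerated :: "nat filter \<Rightarrow> bool" where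
  "conglomerated F \<longleftrightarrow> free_filter F \<and>
     (\<exists>D :: nat \<Rightarrow> nat set.
        disjoint_family D \<and> (\<forall>n. D n \<in> filter_ideal F) \<and>
        (\<forall>M. infinite M \<longrightarrow> (\<Union>n\<in>M. D n) \<in> filter_grill F))"

definition statistical_measure :: "(nat set \<Rightarrow> real) \<Rightarrow> bool" where
  "statistical_measure \<mu> \<longleftrightarrow>
     (\<forall>A. 0 \<le> \<mu> A) \<and> additive UNIV \<mu> \<and> \<mu> UNIV = 1 \<and> (\<forall>k. \<mu> {k} = 0)"

definition generated_by_statistical_measure :: "nat filter \<Rightarrow> bool" where
  "generated_by_statistical_measure F \<longleftrightarrow>
     (\<exists>\<mu>. statistical_measure \<mu> \<and> filter_sets F = {A. \<mu> A = 1})"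

end

theory Submission
  imports Defs "HOL-Analysis.Infinite_Sum"
begin

text \<open>
  The set \<open>\<nat>\<close> carries an uncountable family of infinite sets with pairwise finite
  intersections: identify \<open>\<nat>\<close> with the finite binary words, and assign to every infinite
  binary sequence the set of its prefixes.  If \<open>(D\<^sub>n)\<close> witnesses that \<open>F\<close> is
  conglomerated, then replacing each member \<open>M\<close> of this family by \<open>\<Union>n\<in>M. D\<^sub>n\<close> turns
  infinite sets into members of the grill, and finite intersections into finite unions of the
  \<open>D\<^sub>n\<close>, which lie in the ideal.  The result is an uncountable almost disjoint family
  in the grill, so \<open>F\<close> is not poor.

  On the other hand, the ideal of \<open>F\<^sub>\<mu>\<close> consists of the \<open>\<mu>\<close>-null sets and its grill of the
  sets of positive measure.  On sets with pairwise null intersections \<open>\<mu>\<close> behaves as on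
  disjoint ones, so the measures of the members of an almost disjoint family add up to at most
  \<open>1\<close>; as they are all positive, the family is countable.  Hence a free filter generated by
  a statistical measure is poor, and so it is not conglomerated.
\<close>

lemma filter_ideal_iff: "A \<in> filter_ideal F \<longleftrightarrow> eventually (\<lambda>n. n \<notin> A) F"
proof
  assume "A \<in> filter_ideal F"
  then show "eventually (\<lambda>n. n \<notin> A) F"
    by (auto simp: filter_ideal_def filter_sets_def)
next
  assume "eventually (\<lambda>n. n \<notin> A) F"
  then have "- A \<in> filter_sets F" "A = UNIV - (- A)"
    by (auto simp: filter_sets_def)
  then show "A \<in> filter_ideal F"
    unfolding filter_ideal_def by blast
qed

lemma filter_ideal_finite_UN:
  assumes "finite I" and "\<And>i. i \<in> I \<Longrightarrow> A i \<in> filter_ideal F"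
  shows "(\<Union>i\<in>I. A i) \<in> filter_ideal F"
  using assms by (simp add: filter_ideal_iff eventually_ball_finite)

text \<open>
  Through the encoding of finite words in \<open>\<nat>\<close> this set stands for the branch of the
  binary tree that \<open>s\<close> follows.
\<close>

definition prefix_codes :: "(nat \<Rightarrow> bool) \<Rightarrow> nat set" where
  "prefix_codes s = range (\<lambda>n. to_nat (map s [0..<n]))"

lemma infinite_prefix_codes: "infinite (prefix_codes s)"
proof -
  have "inj (\<lambda>n. to_nat (map s [0..<n]))"
  proof (rule injI)
    fix m n
    assume "to_nat (map s [0..<m]) = to_nat (map s [0..<n])"
    then have "length (map s [0..<m]) = length (map s [0..<n])"
      by simp
    then show "m = n"
      by simp
  qed
  then show ?thesis
    unfolding prefix_codes_def by (rule range_inj_infinite)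
qed

text \<open>
  Distinct sequences differ at some index \<open>k\<close>, so that no word of length greater than
  \<open>k\<close> is a prefix of both.
\<close>

lemma finite_prefix_codes_Int:
  assumes "s \<noteq> t"
  shows "finite (prefix_codes s \<inter> prefix_codes t)"
proof -
  obtain k where k: "s k \<noteq> t k"
    using assms by blast
  have "prefix_codes s \<inter> prefix_codes t \<subseteq> (\<lambda>n. to_nat (map s [0..<n])) ` {..k}"
  proof
    fix c
    assume "c \<in> prefix_codes s \<inter> prefix_codes t"
    then obtain m n where c: "c = to_nat (map s [0..<m])" "c = to_nat (map t [0..<n])"
      unfolding prefix_codes_def by blast
    then have eq: "map s [0..<m] = map t [0..<n]"
      by simp
    then have "length (map s [0..<m]) = length (map t [0..<n])"
      by (rule arg_cong)
    then have "m = n"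
      by simp
    with eq k have "m \<le> k"
      by (auto simp: not_less[symmetric])
    then show "c \<in> (\<lambda>n. to_nat (map s [0..<n])) ` {..k}"
      using c by auto
  qed
  then show ?thesis
    by (rule finite_subset) simp
qed

lemma uncountable_sequences: "uncountable (UNIV :: (nat \<Rightarrow> bool) set)"
proof
  assume "countable (UNIV :: (nat \<Rightarrow> bool) set)"
  define f :: "nat \<Rightarrow> nat \<Rightarrow> bool" where "f = from_nat_into UNIV"
  have f: "range f = UNIV"
    unfolding f_def by (rule range_from_nat_into[OF UNIV_not_empty \<open>countable UNIV\<close>])
  \<comment> \<open>Cantor's diagonal sequence\<close>
  have "(\<lambda>k. \<not> f k k) \<in> range f"
    by (simp add: f)
  then obtain n where "(\<lambda>k. \<not> f k k) = f n"
    by (rule rangeE)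
  then have "(\<not> f n n) = f n n"
    by (rule fun_cong)
  then show False
    by simp
qed

text \<open>
  Since the \<open>D n\<close> are disjoint, \<open>M \<mapsto> (\<Union>n\<in>M. D n)\<close> commutes with
  intersections, so it carries a family of infinite sets with finite intersections to an
  almost disjoint family in the grill.  Distinct members stay distinct because a set of the
  grill is not almost disjoint from itself.
\<close>

lemma conglomerated_imp_not_poor:
  assumes "conglomerated F"
  shows "\<not> poor F"
proof
  assume poor: "poor F"
  from assms obtain D :: "nat \<Rightarrow> nat set" where disj: "disjoint_family D"
    and D: "\<And>n. D n \<in> filter_ideal F"
    and grill: "\<And>M. infinite M \<Longrightarrow> (\<Union>n\<in>M. D n) \<in> filter_grill F"
    unfolding conglomerated_def by blast
  define A where "A s = (\<Union>n\<in>prefix_codes s. D n)" for s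
  have A_grill: "A s \<in> filter_grill F" for s
    unfolding A_def by (rule grill[OF infinite_prefix_codes])
  have A_Int: "A s \<inter> A t \<in> filter_ideal F" if "s \<noteq> t" for s t
  proof -
    have "m = n" if "x \<in> D m" "x \<in> D n" for x m n
      using disjoint_family_onD[OF disj, of m n] that by auto
    then have "A s \<inter> A t = (\<Union>n\<in>prefix_codes s \<inter> prefix_codes t. D n)"
      unfolding A_def by blast
    then show ?thesis
      using filter_ideal_finite_UN[OF finite_prefix_codes_Int[OF that], of D] D by simp
  qed
  have "inj A"
  proof (rule injI, rule ccontr)
    fix s t
    assume "A s = A t" "s \<noteq> t"
    then have "A s \<in> filter_ideal F"
      using A_Int[of s t] by simp
    then show False
      using A_grill[of s] by (simp add: filter_grill_def)
  qed
  have "pairwise (almost_disjoint F) (range A)"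
    by (rule pairwise_imageI) (simp add: almost_disjoint_def A_Int)
  moreover have "range A \<subseteq> filter_grill F"
    using A_grill by blast
  ultimately have "countable (range A)"
    using poor unfolding poor_def by blast
  with \<open>inj A\<close> have "countable (UNIV :: (nat \<Rightarrow> bool) set)"
    by (rule countable_image_inj_on[rotated])
  then show False
    using uncountable_sequences by contradiction
qed

locale generated_filter =
  fixes F :: "nat filter" and \<mu> :: "nat set \<Rightarrow> real"
  assumes measure: "statistical_measure \<mu>"
    and generates: "filter_sets F = {A. \<mu> A = 1}"
begin

lemma nonneg: "0 \<le> \<mu> A"
  using measure by (simp add: statistical_measure_def)

lemma disjoint_Un: "A \<inter> B = {} \<Longrightarrow> \<mu> (A \<union> B) = \<mu> A + \<mu> B"
  using measure by (simp add: statistical_measure_def additive_def)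

lemma Compl_eq: "\<mu> (- A) = 1 - \<mu> A"
  using disjoint_Un[of A "- A"] measure by (simp add: statistical_measure_def)

lemma le_1: "\<mu> A \<le> 1"
  using nonneg[of "- A"] Compl_eq[of A] by simp

lemma ideal_iff_null: "A \<in> filter_ideal F \<longleftrightarrow> \<mu> A = 0"
proof -
  have "A \<in> filter_ideal F \<longleftrightarrow> - A \<in> filter_sets F"
    by (simp add: filter_ideal_iff filter_sets_def)
  then show ?thesis
    by (simp add: generates Compl_eq)
qed

lemma Un_eq_of_null_Int:
  assumes "\<mu> (A \<inter> B) = 0"
  shows "\<mu> (A \<union> B) = \<mu> A + \<mu> B"
proof -
  have "\<mu> (A \<union> B) = \<mu> A + \<mu> (B - A)"
    using disjoint_Un[of A "B - A"] by simp
  moreover have "\<mu> B = \<mu> (A \<inter> B) + \<mu> (B - A)"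
  proof -
    have "(A \<inter> B) \<union> (B - A) = B" "(A \<inter> B) \<inter> (B - A) = {}"
      by blast+
    then show ?thesis
      using disjoint_Un[of "A \<inter> B" "B - A"] by simp
  qed
  ultimately show ?thesis
    using assms by simp
qed

text \<open>
  The overlap of a new member with the union of the others is a finite union of sets of the
  ideal, hence null, and adding the member loses no measure.
\<close>

lemma sum_almost_disjoint:
  assumes "finite \<A>" and "pairwise (almost_disjoint F) \<A>"
  shows "sum \<mu> \<A> = \<mu> (\<Union>\<A>)"
  using assms
proof (induction \<A> rule: finite_induct)
  case empty
  show ?case
    using disjoint_Un[of "{}" "{}"] by simp
next
  case (insert A \<A>)
  have "A \<inter> B \<in> filter_ideal F" if "B \<in> \<A>" for B
    using pairwiseD[OF insert.prems, of A B] insert.hyps(2) that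
    by (auto simp: almost_disjoint_def)
  then have "(\<Union>B\<in>\<A>. A \<inter> B) \<in> filter_ideal F"
    by (rule filter_ideal_finite_UN[OF insert.hyps(1)])
  then have "\<mu> (A \<inter> \<Union>\<A>) = 0"
    unfolding ideal_iff_null Int_Union .
  moreover have "sum \<mu> \<A> = \<mu> (\<Union>\<A>)"
    using insert.IH insert.prems by (simp add: pairwise_insert)
  ultimately show ?case
    using insert.hyps by (simp add: Un_eq_of_null_Int)
qed

text \<open>
  All finite partial sums of \<open>\<mu>\<close> over the family are measures of sets, hence at most
  \<open>1\<close>, and a summable family of positive reals is countable.
\<close>

lemma almost_disjoint_grill_countable:
  assumes grill: "\<A> \<subseteq> filter_grill F" and disj: "pairwise (almost_disjoint F) \<A>"
  shows "countable \<A>"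
proof -
  have "sum \<mu> \<B> \<le> 1" if "finite \<B>" "\<B> \<subseteq> \<A>" for \<B>
    using sum_almost_disjoint[OF that(1) pairwise_subset[OF disj that(2)]] le_1 by simp
  then have "\<mu> summable_on \<A>"
    by (intro nonneg_bdd_above_summable_on nonneg bdd_aboveI2[where M = 1]) auto
  then have "countable {A \<in> \<A>. \<mu> A \<noteq> 0}"
    by (rule summable_countable_real)
  moreover have "{A \<in> \<A>. \<mu> A \<noteq> 0} = \<A>"
    using grill by (auto simp: filter_grill_def ideal_iff_null)
  ultimately show ?thesis
    by simp
qed

end

lemma generated_imp_poor:
  assumes "free_filter F" and "generated_by_statistical_measure F"
  shows "poor F"
proof -
  obtain \<mu> where "statistical_measure \<mu>" "filter_sets F = {A. \<mu> A = 1}"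
    using assms(2) unfolding generated_by_statistical_measure_def by blast
  then interpret generated_filter F \<mu>
    by unfold_locales
  show ?thesis
    using assms(1) almost_disjoint_grill_countable unfolding poor_def by blast
qed

theorem theorem2p4:
  fixes F :: "nat filter"
  assumes "free_filter F" and "conglomerated F"
  shows "\<not> poor F \<and> \<not> generated_by_statistical_measure F"
  using conglomerated_imp_not_poor[OF assms(2)] generated_imp_poor[OF assms(1)] by blast

end
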